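(* No Finsler space $(M,F)$ of non-vanishing scalar curvature $K$ admits a (nonzero) parallel 1-form.
   Context: $M$ is a smooth manifold of dimension $n\ge 2$, $\mathcal{T}M$ is the bundle of nonzero tangent vectors, $(x^i,y^i)$ are the induced coordinates on $TM$, $\partial_i=\partial/\partial x^i$, $\dot\partial_i=\partial/\partial y^i$; the summation convention is used. A Finsler space $(M,F)$ is such an $M$ with a function $F:TM\to\mathbb{R}$ that is strictly positive and smooth on $\mathcal{T}M$, positively 1-homogeneous in $y$, and such that $g_{ij}=\dot\partial_i\dot\partial_j(\tfrac12F^2)$ has rank $n$; $y_i=g_{ij}y^j$. Its geodesic spray is $S=y^j\partial_j-2G^j\dot\partial_j$, with $G^i=\tfrac14 g^{il}\left(y^k\partial_k\dot\partial_l F^2-\partial_l F^2\right)$. Put $N^h_j=\dot\partial_jG^h$ and $G^h_{ij}=\dot\partial_iN^h_j$ (Berwald connection coefficients). The Riemann curvature (Jacobi endomorphism) is $R^i_j=2\partial_jG^i-S(N^i_j)-N^i_kN^k_j$. $(M,F)$ has scalar (flag) curvature if $R^h_i=K\,(F^2\delta^h_i-y_iy^h)$ for some smooth function $K(x,y)$ on $\mathcal{T}M$; the scalar curvature is non-vanishing if $K\ne0$ on $\mathcal{T}M$. A 1-form $\beta=b_i(x)y^i$ is parallel if its Berwald horizontal covariant derivative vanishes: $b_{i|j}=\partial_jb_i-G^h_{ij}b_h=0$ on $\mathcal{T}M$. Parallel 1-forms are understood to be nonzero. *)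

theory Defs
  imports "HOL-Analysis.Analysis"
begin

section \<open>Smooth functions\<close>

text \<open>The sets on which these predicates are used are always open.\<close>

primrec C_k_on :: "nat \<Rightarrow> ('a::real_normed_vector \<Rightarrow> 'b::real_normed_vector) \<Rightarrow> 'a set \<Rightarrow> bool" where
  "C_k_on 0 f S \<longleftrightarrow> continuous_on S f"
| "C_k_on (Suc k) f S \<longleftrightarrow>
     (\<forall>x\<in>S. f differentiable (at x)) \<and>
     (\<forall>v. C_k_on k (\<lambda>x. frechet_derivative f (at x) v) S)"

definition smooth_on :: "'a set \<Rightarrow> ('a::real_normed_vector \<Rightarrow> 'b::real_normed_vector) \<Rightarrow> bool" where
  "smooth_on S f \<longleftrightarrow> (\<forall>k. C_k_on k f S)"


section \<open>Smooth manifolds and their tangent bundles\<close>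

text \<open>A chart is a pair \<open>(U, \<phi>)\<close>; the values of \<open>\<phi>\<close> outside \<open>U\<close> are irrelevant. The dimension
  of the manifold is \<open>CARD('n)\<close>.\<close>

type_synonym ('m, 'n) chart = "'m set \<times> ('m \<Rightarrow> real ^ 'n)"

definition chart_image :: "('m, 'n) chart \<Rightarrow> (real ^ 'n) set" where
  "chart_image c = snd c ` fst c"

definition transition :: "('m, 'n) chart \<Rightarrow> ('m, 'n) chart \<Rightarrow> real ^ 'n \<Rightarrow> real ^ 'n" where
  "transition c d = snd d \<circ> inv_into (fst c) (snd c)"

definition smooth_atlas :: "'m topology \<Rightarrow> ('m, 'n::finite) chart set \<Rightarrow> bool" where
  "smooth_atlas M A \<longleftrightarrow>
     (\<Union>c\<in>A. fst c) = topspace M \<and>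
     (\<forall>c\<in>A. openin M (fst c) \<and> open (chart_image c) \<and>
        homeomorphic_map (subtopology M (fst c)) (top_of_set (chart_image c)) (snd c)) \<and>
     (\<forall>c\<in>A. \<forall>d\<in>A. smooth_on (snd c ` (fst c \<inter> fst d)) (transition c d))"

text \<open>The atlas need not be maximal: it determines the smooth structure, and everything below is
  invariant under a change of coordinates.\<close>

definition smooth_manifold :: "'m topology \<Rightarrow> ('m, 'n::finite) chart set \<Rightarrow> bool" where
  "smooth_manifold M A \<longleftrightarrow> Hausdorff_space M \<and> second_countable M \<and> smooth_atlas M A"

text \<open>A tangent vector at \<open>p\<close> is the family of its component vectors in all charts around \<open>p\<close>, which
  are related by the Jacobians of the transition maps. The components in the remaining charts carry
  no information and are fixed to be 0, so that vectors are equal iff their components are.\<close>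

type_synonym ('m, 'n) tangent = "'m \<times> (('m, 'n) chart \<Rightarrow> real ^ 'n)"

definition tangent_space :: "('m, 'n::finite) chart set \<Rightarrow> 'm \<Rightarrow> (('m, 'n) chart \<Rightarrow> real ^ 'n) set" where
  "tangent_space A p =
     {v. (\<forall>c\<in>A. \<forall>d\<in>A. p \<in> fst c \<inter> fst d \<longrightarrow>
             v d = frechet_derivative (transition c d) (at (snd c p)) (v c)) \<and>
         (\<forall>c. \<not> (c \<in> A \<and> p \<in> fst c) \<longrightarrow> v c = 0)}"

definition tangent_bundle :: "'m topology \<Rightarrow> ('m, 'n::finite) chart set \<Rightarrow> ('m, 'n) tangent set" where
  "tangent_bundle M A = Sigma (topspace M) (tangent_space A)"

definition slit_tangent_bundle :: "'m topology \<Rightarrow> ('m, 'n::finite) chart set \<Rightarrow> ('m, 'n) tangent set" where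
  "slit_tangent_bundle M A = {(p, v) \<in> tangent_bundle M A. v \<noteq> (\<lambda>c. 0)}"

text \<open>The induced coordinates \<open>(x, y)\<close> on \<open>TM\<close>, and the expression in these coordinates of a
  function on \<open>TM\<close>.\<close>

definition induced_coords :: "('m, 'n) chart \<Rightarrow> ('m, 'n) tangent \<Rightarrow> (real ^ 'n) \<times> (real ^ 'n)" where
  "induced_coords c = (\<lambda>(p, v). (snd c p, v c))"

definition local_rep ::
  "('m, 'n::finite) chart set \<Rightarrow> ('m, 'n) chart \<Rightarrow> (('m, 'n) tangent \<Rightarrow> real) \<Rightarrow> (real ^ 'n) \<times> (real ^ 'n) \<Rightarrow> real" where
  "local_rep A c f = f \<circ> inv_into (Sigma (fst c) (tangent_space A)) (induced_coords c)"

definition slit_coords :: "('m, 'n) chart \<Rightarrow> ((real ^ 'n) \<times> (real ^ 'n)) set" where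
  "slit_coords c = chart_image c \<times> (- {0})"

definition smooth_on_slit :: "('m, 'n::finite) chart set \<Rightarrow> (('m, 'n) tangent \<Rightarrow> real) \<Rightarrow> bool" where
  "smooth_on_slit A f \<longleftrightarrow> (\<forall>c\<in>A. smooth_on (slit_coords c) (local_rep A c f))"


section \<open>Finsler geometry in induced coordinates\<close>

text \<open>In this section \<open>f\<close> is the local expression of the Finsler function and a point \<open>z = (x, y)\<close>
  has \<open>y = snd z\<close>.\<close>

definition dx :: "'n::finite \<Rightarrow> ((real ^ 'n) \<times> (real ^ 'n) \<Rightarrow> real) \<Rightarrow> (real ^ 'n) \<times> (real ^ 'n) \<Rightarrow> real" where
  "dx i f z = frechet_derivative f (at z) (axis i 1, 0)"

definition dy :: "'n::finite \<Rightarrow> ((real ^ 'n) \<times> (real ^ 'n) \<Rightarrow> real) \<Rightarrow> (real ^ 'n) \<times> (real ^ 'n) \<Rightarrow> real" where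
  "dy i f z = frechet_derivative f (at z) (0, axis i 1)"

definition metric :: "((real ^ 'n) \<times> (real ^ 'n) \<Rightarrow> real) \<Rightarrow> (real ^ 'n) \<times> (real ^ 'n) \<Rightarrow> real ^ 'n ^ 'n::finite" where
  "metric f z = (\<chi> i j. dy i (dy j (\<lambda>w. (f w)\<^sup>2 / 2)) z)"

definition y_lower :: "((real ^ 'n) \<times> (real ^ 'n) \<Rightarrow> real) \<Rightarrow> 'n::finite \<Rightarrow> (real ^ 'n) \<times> (real ^ 'n) \<Rightarrow> real" where
  "y_lower f i z = (\<Sum>j\<in>UNIV. metric f z $ i $ j * snd z $ j)"

definition spray_coeff :: "((real ^ 'n) \<times> (real ^ 'n) \<Rightarrow> real) \<Rightarrow> 'n::finite \<Rightarrow> (real ^ 'n) \<times> (real ^ 'n) \<Rightarrow> real" where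
  "spray_coeff f i z = 1/4 * (\<Sum>l\<in>UNIV. matrix_inv (metric f z) $ i $ l *
     ((\<Sum>k\<in>UNIV. snd z $ k * dx k (dy l (\<lambda>w. (f w)\<^sup>2)) z) - dx l (\<lambda>w. (f w)\<^sup>2) z))"

definition spray ::
  "((real ^ 'n) \<times> (real ^ 'n) \<Rightarrow> real) \<Rightarrow> ((real ^ 'n) \<times> (real ^ 'n) \<Rightarrow> real) \<Rightarrow> (real ^ 'n::finite) \<times> (real ^ 'n) \<Rightarrow> real" where
  "spray f \<phi> z = (\<Sum>j\<in>UNIV. snd z $ j * dx j \<phi> z) - 2 * (\<Sum>j\<in>UNIV. spray_coeff f j z * dy j \<phi> z)"

text \<open>\<open>nonlinear_conn f h j\<close> is $N^h_j$, \<open>berwald_coeff f h i j\<close> is $G^h_{ij}$, and \<open>jacobi_endo f i j\<close>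
  is $R^i_j$.\<close>

definition nonlinear_conn ::
  "((real ^ 'n) \<times> (real ^ 'n) \<Rightarrow> real) \<Rightarrow> 'n \<Rightarrow> 'n::finite \<Rightarrow> (real ^ 'n) \<times> (real ^ 'n) \<Rightarrow> real" where
  "nonlinear_conn f h j = dy j (spray_coeff f h)"

definition berwald_coeff ::
  "((real ^ 'n) \<times> (real ^ 'n) \<Rightarrow> real) \<Rightarrow> 'n \<Rightarrow> 'n \<Rightarrow> 'n::finite \<Rightarrow> (real ^ 'n) \<times> (real ^ 'n) \<Rightarrow> real" where
  "berwald_coeff f h i j = dy i (nonlinear_conn f h j)"

definition jacobi_endo ::
  "((real ^ 'n) \<times> (real ^ 'n) \<Rightarrow> real) \<Rightarrow> 'n \<Rightarrow> 'n::finite \<Rightarrow> (real ^ 'n) \<times> (real ^ 'n) \<Rightarrow> real" where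
  "jacobi_endo f i j z = 2 * dx j (spray_coeff f i) z - spray f (nonlinear_conn f i j) z
     - (\<Sum>k\<in>UNIV. nonlinear_conn f i k z * nonlinear_conn f k j z)"


section \<open>Finsler spaces, scalar curvature, parallel 1-forms\<close>

definition finsler_space ::
  "'m topology \<Rightarrow> ('m, 'n::finite) chart set \<Rightarrow> (('m, 'n) tangent \<Rightarrow> real) \<Rightarrow> bool" where
  "finsler_space M A F \<longleftrightarrow>
     smooth_manifold M A \<and> CARD('n) \<ge> 2 \<and>
     (\<forall>u\<in>slit_tangent_bundle M A. F u > 0) \<and>
     smooth_on_slit A F \<and>
     (\<forall>(p, v)\<in>tangent_bundle M A. \<forall>r>0. F (p, \<lambda>c. r *\<^sub>R v c) = r * F (p, v)) \<and>
     (\<forall>c\<in>A. \<forall>z\<in>slit_coords c. rank (metric (local_rep A c F) z) = CARD('n))"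

definition has_scalar_curvature ::
  "('m, 'n::finite) chart set \<Rightarrow> (('m, 'n) tangent \<Rightarrow> real) \<Rightarrow> (('m, 'n) tangent \<Rightarrow> real) \<Rightarrow> bool" where
  "has_scalar_curvature A F K \<longleftrightarrow>
     smooth_on_slit A K \<and>
     (\<forall>c\<in>A. \<forall>z\<in>slit_coords c. \<forall>h i.
        jacobi_endo (local_rep A c F) h i z =
          local_rep A c K z *
            ((local_rep A c F z)\<^sup>2 * (if h = i then 1 else 0)
              - y_lower (local_rep A c F) i z * snd z $ h))"

text \<open>A 1-form is viewed as a function on \<open>TM\<close>; its components $b_i(x)$ in a chart are its values
  on the coordinate vectors.\<close>

definition form_coeff ::
  "('m, 'n::finite) chart set \<Rightarrow> ('m, 'n) chart \<Rightarrow> (('m, 'n) tangent \<Rightarrow> real) \<Rightarrow> 'n \<Rightarrow> real ^ 'n \<Rightarrow> real" where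
  "form_coeff A c \<beta> i x = local_rep A c \<beta> (x, axis i 1)"

definition one_form :: "('m, 'n::finite) chart set \<Rightarrow> (('m, 'n) tangent \<Rightarrow> real) \<Rightarrow> bool" where
  "one_form A \<beta> \<longleftrightarrow>
     (\<forall>c\<in>A. (\<forall>i. smooth_on (chart_image c) (form_coeff A c \<beta> i)) \<and>
        (\<forall>x\<in>chart_image c. \<forall>y.
           local_rep A c \<beta> (x, y) = (\<Sum>i\<in>UNIV. form_coeff A c \<beta> i x * y $ i)))"

definition horizontal_deriv ::
  "('m, 'n::finite) chart set \<Rightarrow> ('m, 'n) chart \<Rightarrow> (('m, 'n) tangent \<Rightarrow> real) \<Rightarrow> (('m, 'n) tangent \<Rightarrow> real)
     \<Rightarrow> 'n \<Rightarrow> 'n \<Rightarrow> (real ^ 'n) \<times> (real ^ 'n) \<Rightarrow> real" where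
  "horizontal_deriv A c F \<beta> i j z =
     frechet_derivative (form_coeff A c \<beta> i) (at (fst z)) (axis j 1)
       - (\<Sum>h\<in>UNIV. berwald_coeff (local_rep A c F) h i j z * form_coeff A c \<beta> h (fst z))"

definition parallel ::
  "('m, 'n::finite) chart set \<Rightarrow> (('m, 'n) tangent \<Rightarrow> real) \<Rightarrow> (('m, 'n) tangent \<Rightarrow> real) \<Rightarrow> bool" where
  "parallel A F \<beta> \<longleftrightarrow>
     (\<forall>c\<in>A. \<forall>z\<in>slit_coords c. \<forall>i j. horizontal_deriv A c F \<beta> i j z = 0)"

end

theory Submission
  imports Defs
begin

text \<open>
  A parallel 1-form \<open>\<beta> = b\<^sub>i(x) y\<^sup>i\<close> is annihilated by the curvature: \<open>b\<^sub>h R\<^sup>h\<^sub>j = 0\<close>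
  (\<open>parallel_form_annihilates_curvature\<close>). For scalar curvature this reads
  \<open>K (F\<^sup>2 b\<^sub>j - y\<^sub>j \<beta>(y)) = 0\<close>, so \<open>F\<^sup>2 b\<^sub>j = y\<^sub>j \<beta>(y)\<close> because \<open>K\<close> does not vanish. In dimension at
  least 2 every fibre contains a vector \<open>y \<noteq> 0\<close> with \<open>\<beta>(y) = 0\<close>; evaluating there gives
  \<open>F\<^sup>2 b\<^sub>j = 0\<close>, hence \<open>b = 0\<close> at the base point. Since the base point is arbitrary, \<open>\<beta> = 0\<close>.

  The identity \<open>b\<^sub>h R\<^sup>h\<^sub>j = 0\<close> is an instance of the Ricci identity, obtained here directly in one
  chart. Write \<open>B\<^sub>i\<^sub>j = \<partial>\<^sub>j b\<^sub>i\<close>, a function of \<open>x\<close> only. Contracting \<open>B\<^sub>i\<^sub>j = G\<^sup>h\<^sub>i\<^sub>j b\<^sub>h\<close> with \<open>y\<close> once and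
  twice, and applying Euler's relation to \<open>N\<^sup>h\<^sub>j\<close> and \<open>G\<^sup>h\<close>, gives
  \<open>b\<^sub>h N\<^sup>h\<^sub>j = y\<^sup>i B\<^sub>i\<^sub>j\<close> and \<open>2 b\<^sub>h G\<^sup>h = y\<^sup>i y\<^sup>j B\<^sub>i\<^sub>j\<close>. A vertical derivative of the second relation,
  compared with the first, yields \<open>y\<^sup>i B\<^sub>k\<^sub>i = y\<^sup>i B\<^sub>i\<^sub>k\<close>. Differentiating the second relation along
  \<open>x\<^sup>j\<close> and the first along the spray expresses the three terms of \<open>b\<^sub>h R\<^sup>h\<^sub>j\<close> by \<open>B\<close>, \<open>N\<close> and \<open>G\<close>;
  everything cancels except \<open>y\<^sup>i y\<^sup>l (\<partial>\<^sub>j B\<^sub>i\<^sub>l - \<partial>\<^sub>l B\<^sub>i\<^sub>j)\<close>, which vanishes because second derivatives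
  of \<open>b\<^sub>i\<close> commute.

  The argument needs \<open>G\<^sup>h\<close> to be smooth, which follows from the smoothness of \<open>F\<close> and Cramer's rule for
  the inverse of the metric, and it needs coordinates \<open>(x, y)\<close> with arbitrary \<open>y\<close> to come from
  tangent vectors, which is the cocycle property of the Jacobians of the transition maps.
\<close>

section \<open>Calculus of smooth functions\<close>

lemma C_k_on_cong:
  assumes "open S" "\<And>x. x \<in> S \<Longrightarrow> f x = g x" "C_k_on k f S"
  shows "C_k_on k g S"
  using assms(2,3)
proof (induction k arbitrary: f g)
  case 0
  then show ?case by (metis C_k_on.simps(1) continuous_on_cong)
next
  case (Suc k)
  have d: "frechet_derivative f (at x) = frechet_derivative g (at x)" if "x \<in> S" for x
    using Suc.prems that assms(1) by (intro frechet_derivative_transform_within_open) auto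
  have "g differentiable at x" if "x \<in> S" for x
    using Suc.prems that assms(1) has_derivative_transform_within_open
    by (metis C_k_on.simps(2) differentiable_def)
  moreover have "C_k_on k (\<lambda>x. frechet_derivative g (at x) v) S" for v
    using Suc.IH[of "\<lambda>x. frechet_derivative f (at x) v" "\<lambda>x. frechet_derivative g (at x) v"]
      Suc.prems d by auto
  ultimately show ?case by simp
qed

text \<open>Closure properties are proved by induction on the order of differentiability. This introduction
  rule allows any explicit expression for the derivative in place of the Frechet derivative operator.\<close>

lemma C_k_on_SucI:
  assumes "open S"
    and "\<And>x. x \<in> S \<Longrightarrow> (f has_derivative D x) (at x)"
    and "\<And>v. C_k_on k (\<lambda>x. D x v) S"
  shows "C_k_on (Suc k) f S"
proof -
  have "frechet_derivative f (at x) = D x" if "x \<in> S" for x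
    using assms(2) that frechet_derivative_at by metis
  then have "C_k_on k (\<lambda>x. frechet_derivative f (at x) v) S" for v
    using C_k_on_cong[OF assms(1) _ assms(3)[of v]] by simp
  then show ?thesis
    using assms(2) by (auto simp: differentiable_def)
qed

lemma C_k_on_SucD: "C_k_on (Suc k) f S \<Longrightarrow> C_k_on k f S"
proof (induction k arbitrary: f)
  case 0
  then show ?case
    by (meson C_k_on.simps continuous_at_imp_continuous_on differentiable_imp_continuous_within)
next
  case (Suc k)
  then show ?case by (metis C_k_on.simps(2))
qed

lemma C_k_on_Suc_has_derivative:
  "C_k_on (Suc k) f S \<Longrightarrow> x \<in> S \<Longrightarrow> (f has_derivative frechet_derivative f (at x)) (at x)"
  by (simp add: frechet_derivative_works)

lemma C_k_on_const:
  assumes "open S"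
  shows "C_k_on k (\<lambda>x. a) S"
proof (induction k arbitrary: a)
  case (Suc k)
  show ?case by (rule C_k_on_SucI[OF assms has_derivative_const Suc.IH])
qed simp

lemma C_k_on_bounded_linear:
  assumes "open S" "bounded_linear f"
  shows "C_k_on k f S"
proof (cases k)
  case 0
  then show ?thesis using assms(2) by (simp add: linear_continuous_on)
next
  case (Suc k')
  show ?thesis
    unfolding Suc
    by (rule C_k_on_SucI[OF assms(1) bounded_linear_imp_has_derivative[OF assms(2)] C_k_on_const[OF assms(1)]])
qed

lemma C_k_on_add:
  assumes "open S" "C_k_on k f S" "C_k_on k g S"
  shows "C_k_on k (\<lambda>x. f x + g x) S"
  using assms(2,3)
proof (induction k arbitrary: f g)
  case 0
  then show ?case by (simp add: continuous_on_add)
next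
  case (Suc k)
  show ?case
  proof (rule C_k_on_SucI[OF assms(1)])
    show "((\<lambda>x. f x + g x) has_derivative
        (\<lambda>v. frechet_derivative f (at x) v + frechet_derivative g (at x) v)) (at x)" if "x \<in> S" for x
      using Suc.prems that by (intro has_derivative_add C_k_on_Suc_has_derivative)
    show "C_k_on k (\<lambda>x. frechet_derivative f (at x) v + frechet_derivative g (at x) v) S" for v
      using Suc.prems by (intro Suc.IH) simp_all
  qed
qed

lemma C_k_on_mult:
  fixes f g :: "'a::real_normed_vector \<Rightarrow> real"
  assumes "open S" "C_k_on k f S" "C_k_on k g S"
  shows "C_k_on k (\<lambda>x. f x * g x) S"
  using assms(2,3)
proof (induction k arbitrary: f g)
  case 0
  then show ?case by (simp add: continuous_on_mult)
next
  case (Suc k)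
  show ?case
  proof (rule C_k_on_SucI[OF assms(1)])
    show "((\<lambda>x. f x * g x) has_derivative
        (\<lambda>v. f x * frechet_derivative g (at x) v + frechet_derivative f (at x) v * g x)) (at x)"
      if "x \<in> S" for x
      using Suc.prems that by (intro has_derivative_mult C_k_on_Suc_has_derivative)
    show "C_k_on k (\<lambda>x. f x * frechet_derivative g (at x) v + frechet_derivative f (at x) v * g x) S" for v
      using Suc.prems C_k_on_SucD[OF Suc.prems(1)] C_k_on_SucD[OF Suc.prems(2)]
      by (intro C_k_on_add[OF assms(1)] Suc.IH) simp_all
  qed
qed

lemma C_k_on_inverse:
  fixes f :: "'a::real_normed_vector \<Rightarrow> real"
  assumes "open S" "C_k_on k f S" "\<And>x. x \<in> S \<Longrightarrow> f x \<noteq> 0"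
  shows "C_k_on k (\<lambda>x. inverse (f x)) S"
  using assms(2)
proof (induction k)
  case 0
  then show ?case using assms(3) by (simp add: continuous_on_inverse)
next
  case (Suc k)
  have IH: "C_k_on k (\<lambda>x. inverse (f x)) S"
    by (rule Suc.IH[OF C_k_on_SucD[OF Suc.prems]])
  show ?case
  proof (rule C_k_on_SucI[OF assms(1)])
    show "((\<lambda>x. inverse (f x)) has_derivative
        (\<lambda>v. (-1) * (inverse (f x) * frechet_derivative f (at x) v * inverse (f x)))) (at x)"
      if "x \<in> S" for x
      using Deriv.has_derivative_inverse[OF assms(3)[OF that] C_k_on_Suc_has_derivative[OF Suc.prems that]]
      by simp
    show "C_k_on k (\<lambda>x. (-1) * (inverse (f x) * frechet_derivative f (at x) v * inverse (f x))) S" for v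
      using Suc.prems by (intro C_k_on_mult[OF assms(1)] C_k_on_const[OF assms(1)] IH) simp
  qed
qed

lemma smooth_on_const: "open S \<Longrightarrow> smooth_on S (\<lambda>x. a)"
  by (simp add: smooth_on_def C_k_on_const)

lemma smooth_on_bounded_linear: "open S \<Longrightarrow> bounded_linear f \<Longrightarrow> smooth_on S f"
  by (simp add: smooth_on_def C_k_on_bounded_linear)

lemma smooth_on_add: "open S \<Longrightarrow> smooth_on S f \<Longrightarrow> smooth_on S g \<Longrightarrow> smooth_on S (\<lambda>x. f x + g x)"
  by (simp add: smooth_on_def C_k_on_add)

lemma smooth_on_mult:
  fixes f g :: "'a::real_normed_vector \<Rightarrow> real"
  shows "open S \<Longrightarrow> smooth_on S f \<Longrightarrow> smooth_on S g \<Longrightarrow> smooth_on S (\<lambda>x. f x * g x)"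
  by (simp add: smooth_on_def C_k_on_mult)

lemma smooth_on_divide:
  fixes f g :: "'a::real_normed_vector \<Rightarrow> real"
  assumes "open S" "smooth_on S f" "smooth_on S g" "\<And>x. x \<in> S \<Longrightarrow> g x \<noteq> 0"
  shows "smooth_on S (\<lambda>x. f x / g x)"
  using assms by (simp add: smooth_on_def divide_inverse C_k_on_mult C_k_on_inverse)

lemma smooth_on_diff:
  fixes f g :: "'a::real_normed_vector \<Rightarrow> real"
  assumes "open S" "smooth_on S f" "smooth_on S g"
  shows "smooth_on S (\<lambda>x. f x - g x)"
  using smooth_on_add[OF assms(1,2) smooth_on_mult[OF assms(1) smooth_on_const[OF assms(1), of "-1"] assms(3)]]
  by simp

lemma smooth_on_sum:
  fixes f :: "'i \<Rightarrow> 'a::real_normed_vector \<Rightarrow> real"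
  assumes "open S" "\<And>i. i \<in> I \<Longrightarrow> smooth_on S (f i)"
  shows "smooth_on S (\<lambda>x. \<Sum>i\<in>I. f i x)"
  using assms(2)
  by (induction I rule: infinite_finite_induct) (auto intro: smooth_on_const smooth_on_add assms(1))

lemma smooth_on_prod:
  fixes f :: "'i \<Rightarrow> 'a::real_normed_vector \<Rightarrow> real"
  assumes "open S" "\<And>i. i \<in> I \<Longrightarrow> smooth_on S (f i)"
  shows "smooth_on S (\<lambda>x. \<Prod>i\<in>I. f i x)"
  using assms(2)
  by (induction I rule: infinite_finite_induct) (auto intro: smooth_on_const smooth_on_mult assms(1))

lemma smooth_on_cong:
  assumes "open S" "\<And>x. x \<in> S \<Longrightarrow> f x = g x" "smooth_on S f"
  shows "smooth_on S g"
  using assms by (meson C_k_on_cong smooth_on_def)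

lemma smooth_on_frechet_derivative:
  "smooth_on S f \<Longrightarrow> smooth_on S (\<lambda>x. frechet_derivative f (at x) v)"
  unfolding smooth_on_def using C_k_on.simps(2) by blast

lemma smooth_on_differentiable: "smooth_on S f \<Longrightarrow> x \<in> S \<Longrightarrow> f differentiable at x"
  by (meson C_k_on.simps(2) smooth_on_def)

lemma smooth_on_has_derivative:
  "smooth_on S f \<Longrightarrow> x \<in> S \<Longrightarrow> (f has_derivative frechet_derivative f (at x)) (at x)"
  using frechet_derivative_works smooth_on_differentiable by blast

lemma smooth_on_continuous: "smooth_on S f \<Longrightarrow> continuous_on S f"
  by (meson C_k_on.simps(1) smooth_on_def)

lemma smooth_on_det:
  fixes A :: "'a::real_normed_vector \<Rightarrow> real ^ 'n ^ 'n::finite"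
  assumes "open S" "\<And>i j. smooth_on S (\<lambda>x. A x $ i $ j)"
  shows "smooth_on S (\<lambda>x. det (A x))"
  unfolding det_def
  by (intro smooth_on_sum smooth_on_mult smooth_on_const smooth_on_prod assms)

text \<open>Cramer's rule writes the entries of the inverse matrix as rational functions of the entries
  of the matrix.\<close>

lemma matrix_inv_component:
  fixes A :: "real ^ 'n ^ 'n::finite"
  assumes "det A \<noteq> 0"
  shows "matrix_inv A $ i $ j =
    det (\<chi> k l. if l = i then axis j 1 $ k else A $ k $ l) / det A"
proof -
  have "\<exists>B. A ** B = mat 1 \<and> B ** A = mat 1"
    using assms by (simp add: invertible_det_nz[symmetric] invertible_def)
  then have "A ** matrix_inv A = mat 1"
    unfolding matrix_inv_def by (rule someI2_ex) simp
  then have "A *v (matrix_inv A *v axis j 1) = axis j 1"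
    by (simp add: matrix_vector_mul_assoc)
  then have "matrix_inv A *v axis j 1 =
      (\<chi> i. det (\<chi> k l. if l = i then axis j 1 $ k else A $ k $ l) / det A)"
    using cramer[OF assms] by blast
  then show ?thesis
    by (simp add: matrix_vector_mult_basis column_def vec_eq_iff)
qed

lemma smooth_on_matrix_inv:
  fixes A :: "'a::real_normed_vector \<Rightarrow> real ^ 'n ^ 'n::finite"
  assumes "open S" "\<And>i j. smooth_on S (\<lambda>x. A x $ i $ j)" "\<And>x. x \<in> S \<Longrightarrow> det (A x) \<noteq> 0"
  shows "smooth_on S (\<lambda>x. matrix_inv (A x) $ i $ j)"
proof (rule smooth_on_cong[OF assms(1)])
  show "det (\<chi> k l. if l = i then axis j 1 $ k else A x $ k $ l) / det (A x) = matrix_inv (A x) $ i $ j"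
    if "x \<in> S" for x
    using matrix_inv_component[OF assms(3)[OF that]] by simp
  have "smooth_on S (\<lambda>x. (\<chi> k l. if l = i then axis j 1 $ k else A x $ k $ l) $ m $ p)" for m p
    by (cases "p = i") (auto simp: assms smooth_on_const)
  then show "smooth_on S (\<lambda>x. det (\<chi> k l. if l = i then axis j 1 $ k else A x $ k $ l) / det (A x))"
    by (rule smooth_on_divide[OF assms(1) smooth_on_det[OF assms(1)] smooth_on_det[OF assms(1,2)] assms(3)])
qed

section \<open>Symmetry of second derivatives\<close>

lemma has_real_derivative_along_line:
  fixes f :: "'a::real_normed_vector \<Rightarrow> real"
  assumes "f differentiable at (p + s *\<^sub>R u)"
  shows "((\<lambda>s. f (p + s *\<^sub>R u)) has_real_derivative frechet_derivative f (at (p + s *\<^sub>R u)) u) (at s)"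
proof -
  have d: "((\<lambda>s. p + s *\<^sub>R u) has_derivative (\<lambda>t. t *\<^sub>R u)) (at s)"
    by (auto intro!: derivative_eq_intros)
  have "((\<lambda>s. f (p + s *\<^sub>R u)) has_derivative
      (\<lambda>t. frechet_derivative f (at (p + s *\<^sub>R u)) (t *\<^sub>R u))) (at s)"
    using diff_chain_at[OF d frechet_derivative_works[THEN iffD1, OF assms]] by (simp add: o_def)
  moreover have "frechet_derivative f (at (p + s *\<^sub>R u)) (t *\<^sub>R u)
      = frechet_derivative f (at (p + s *\<^sub>R u)) u * t" for t
    using linear_scale[OF linear_frechet_derivative[OF assms]] by (simp add: mult.commute)
  ultimately show ?thesis
    by (simp add: has_field_derivative_def)
qed

text \<open>Two applications of the mean value theorem turn the second difference quotient into a value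
  of the iterated derivative at a nearby point.\<close>

lemma second_difference_quotient_tendsto:
  fixes f :: "'a::real_normed_vector \<Rightarrow> real" and a u v :: 'a
  assumes S: "open S" "a \<in> S" and f: "smooth_on S f"
  defines "Du \<equiv> \<lambda>x. frechet_derivative f (at x) u"
  shows "((\<lambda>t. (f (a + t *\<^sub>R u + t *\<^sub>R v) - f (a + t *\<^sub>R u) - f (a + t *\<^sub>R v) + f a) / t\<^sup>2)
     \<longlongrightarrow> frechet_derivative Du (at a) v) (at_right 0)"
proof -
  define E where "E = (\<lambda>x. frechet_derivative Du (at x) v)"
  have Du: "smooth_on S Du"
    unfolding Du_def by (rule smooth_on_frechet_derivative[OF f])
  have "continuous_on S E"
    unfolding E_def by (rule smooth_on_continuous[OF smooth_on_frechet_derivative[OF Du]])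
  then have E: "isCont E a"
    using S by (simp add: continuous_on_eq_continuous_at)
  have E_a: "frechet_derivative Du (at a) v = E a"
    by (simp add: E_def)
  show ?thesis
    unfolding tendsto_iff E_a
  proof (intro allI impI)
    fix e :: real assume "e > 0"
    obtain d1 where d1: "d1 > 0" "ball a d1 \<subseteq> S"
      using S openE by blast
    obtain d2 where d2: "d2 > 0" "\<And>x. dist x a < d2 \<Longrightarrow> dist (E x) (E a) < e"
      using E \<open>e > 0\<close> unfolding continuous_at_eps_delta by (metis dist_norm)
    define d where "d = min d1 d2 / (norm u + norm v + 1)"
    have pos: "norm u + norm v + 1 > 0"
      by (smt (verit) norm_ge_zero)
    have "d > 0"
      unfolding d_def using d1 d2 pos by simp
    have near: "dist (a + s *\<^sub>R u + s' *\<^sub>R v) a < min d1 d2"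
      if "0 \<le> s" "s \<le> t" "0 \<le> s'" "s' \<le> t" "t < d" for s s' t
    proof -
      have "dist (a + s *\<^sub>R u + s' *\<^sub>R v) a = norm (s *\<^sub>R u + s' *\<^sub>R v)"
        by (simp add: dist_norm add.assoc)
      also have "\<dots> \<le> s * norm u + s' * norm v"
        using that norm_triangle_ineq[of "s *\<^sub>R u" "s' *\<^sub>R v"] by simp
      also have "\<dots> \<le> t * norm u + t * norm v"
        using that by (intro add_mono mult_right_mono) auto
      also have "\<dots> \<le> t * (norm u + norm v + 1)"
        using that by (simp add: algebra_simps)
      also have "\<dots> < d * (norm u + norm v + 1)"
        using that pos by simp
      finally show ?thesis
        using pos by (simp add: d_def)
    qed
    have inS: "a + s *\<^sub>R u + s' *\<^sub>R v \<in> S"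
      if "0 \<le> s" "s \<le> t" "0 \<le> s'" "s' \<le> t" "t < d" for s s' t
      using near[OF that] d1(2) by (auto simp: dist_commute)
    have "dist ((f (a + t *\<^sub>R u + t *\<^sub>R v) - f (a + t *\<^sub>R u) - f (a + t *\<^sub>R v) + f a) / t\<^sup>2) (E a) < e"
      if t: "0 < t" "t < d" for t
    proof -
      define g where "g = (\<lambda>s. f ((a + t *\<^sub>R v) + s *\<^sub>R u) - f (a + s *\<^sub>R u))"
      have "\<exists>s>0. s < t \<and> g t - g 0 = (t - 0) * (Du ((a + t *\<^sub>R v) + s *\<^sub>R u) - Du (a + s *\<^sub>R u))"
      proof (rule MVT2[OF t(1)])
        fix s assume s: "0 \<le> s" "s \<le> t"
        have "f differentiable at ((a + t *\<^sub>R v) + s *\<^sub>R u)" "f differentiable at (a + s *\<^sub>R u)"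
          using inS[of s t t] inS[of s t 0] s t smooth_on_differentiable[OF f]
          by (auto simp: add_ac)
        then show "DERIV g s :> Du ((a + t *\<^sub>R v) + s *\<^sub>R u) - Du (a + s *\<^sub>R u)"
          unfolding g_def Du_def by (intro DERIV_diff has_real_derivative_along_line)
      qed
      then obtain s where s: "0 < s" "s < t"
        "g t - g 0 = t * (Du ((a + t *\<^sub>R v) + s *\<^sub>R u) - Du (a + s *\<^sub>R u))" by auto
      have "\<exists>r>0. r < t \<and> Du ((a + s *\<^sub>R u) + t *\<^sub>R v) - Du ((a + s *\<^sub>R u) + 0 *\<^sub>R v)
          = (t - 0) * E ((a + s *\<^sub>R u) + r *\<^sub>R v)"
      proof (rule MVT2[OF t(1), of "\<lambda>r. Du ((a + s *\<^sub>R u) + r *\<^sub>R v)"])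
        fix r assume r: "0 \<le> r" "r \<le> t"
        have "Du differentiable at ((a + s *\<^sub>R u) + r *\<^sub>R v)"
          using inS[of s t r] s r t smooth_on_differentiable[OF Du] by auto
        then show "DERIV (\<lambda>r. Du ((a + s *\<^sub>R u) + r *\<^sub>R v)) r :> E ((a + s *\<^sub>R u) + r *\<^sub>R v)"
          unfolding E_def by (rule has_real_derivative_along_line)
      qed
      then obtain r where r: "0 < r" "r < t"
        "Du ((a + s *\<^sub>R u) + t *\<^sub>R v) - Du (a + s *\<^sub>R u) = t * E ((a + s *\<^sub>R u) + r *\<^sub>R v)" by auto
      have "g t - g 0 = t\<^sup>2 * E ((a + s *\<^sub>R u) + r *\<^sub>R v)"
        using s(3) r(3) by (simp add: add_ac power2_eq_square)
      moreover have "g t - g 0 = f (a + t *\<^sub>R u + t *\<^sub>R v) - f (a + t *\<^sub>R u) - f (a + t *\<^sub>R v) + f a"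
        by (simp add: g_def add_ac)
      ultimately have "(f (a + t *\<^sub>R u + t *\<^sub>R v) - f (a + t *\<^sub>R u) - f (a + t *\<^sub>R v) + f a) / t\<^sup>2
          = E (a + s *\<^sub>R u + r *\<^sub>R v)"
        using t(1) by (metis nonzero_mult_div_cancel_left power_not_zero less_irrefl)
      then show ?thesis
        using d2(2)[of "a + s *\<^sub>R u + r *\<^sub>R v"] near[of s t r] s r t by simp
    qed
    then show "\<forall>\<^sub>F t in at_right 0.
        dist ((f (a + t *\<^sub>R u + t *\<^sub>R v) - f (a + t *\<^sub>R u) - f (a + t *\<^sub>R v) + f a) / t\<^sup>2) (E a) < e"
      unfolding eventually_at_right_field using \<open>d > 0\<close> by blast
  qed
qed

text \<open>The second difference is symmetric in the two directions, so both iterated derivatives are limits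
  of the same quotient.\<close>

lemma second_derivative_symmetric:
  fixes f :: "'a::real_normed_vector \<Rightarrow> real"
  assumes "open S" "a \<in> S" "smooth_on S f"
  shows "frechet_derivative (\<lambda>x. frechet_derivative f (at x) u) (at a) v
    = frechet_derivative (\<lambda>x. frechet_derivative f (at x) v) (at a) u"
proof -
  have "((\<lambda>t. (f (a + t *\<^sub>R u + t *\<^sub>R v) - f (a + t *\<^sub>R u) - f (a + t *\<^sub>R v) + f a) / t\<^sup>2)
     \<longlongrightarrow> frechet_derivative (\<lambda>x. frechet_derivative f (at x) v) (at a) u) (at_right 0)"
    using second_difference_quotient_tendsto[OF assms, of v u]
    by (simp add: add_ac diff_diff_eq)
  with second_difference_quotient_tendsto[OF assms] show ?thesis
    by (rule tendsto_unique[OF trivial_limit_at_right_real])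
qed

section \<open>Coordinate derivatives and homogeneity\<close>

lemma linear_eq_sum_axis:
  fixes g :: "real ^ 'n::finite \<Rightarrow> real"
  assumes "linear g"
  shows "g u = (\<Sum>i\<in>UNIV. u $ i * g (axis i 1))"
proof -
  have "u = (\<Sum>i\<in>UNIV. u $ i *\<^sub>R axis i 1)"
    using basis_expansion[of u] by (simp add: scalar_mult_eq_scaleR)
  then have "g u = g (\<Sum>i\<in>UNIV. u $ i *\<^sub>R axis i 1)"
    by simp
  also have "\<dots> = (\<Sum>i\<in>UNIV. u $ i * g (axis i 1))"
    using assms by (simp add: linear_sum linear_scale)
  finally show ?thesis .
qed

lemma frechet_derivative_eq_sum_dx_dy:
  assumes "\<phi> differentiable at z"
  shows "frechet_derivative \<phi> (at z) (u, v) =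
    (\<Sum>i\<in>UNIV. u $ i * dx i \<phi> z) + (\<Sum>i\<in>UNIV. v $ i * dy i \<phi> z)"
proof -
  define L where "L = frechet_derivative \<phi> (at z)"
  have L: "linear L"
    unfolding L_def by (rule linear_frechet_derivative[OF assms])
  have "linear (\<lambda>u. L (u, 0))" "linear (\<lambda>v. L (0, v))"
    using linear_compose[OF _ L, of "\<lambda>u. (u, 0)"] linear_compose[OF _ L, of "\<lambda>v. (0, v)"]
    by (simp_all add: o_def linear_iff)
  then have "L (u, 0) = (\<Sum>i\<in>UNIV. u $ i * L (axis i 1, 0))"
      "L (0, v) = (\<Sum>i\<in>UNIV. v $ i * L (0, axis i 1))"
    using linear_eq_sum_axis[of "\<lambda>u. L (u, 0)" u] linear_eq_sum_axis[of "\<lambda>v. L (0, v)" v] by auto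
  moreover have "L (u, v) = L (u, 0) + L (0, v)"
    using linear_add[OF L, of "(u, 0)" "(0, v)"] by simp
  ultimately show ?thesis
    by (simp add: L_def dx_def dy_def)
qed

text \<open>As a directional derivative the spray can be applied to both sides of an identity between
  functions of \<open>(x, y)\<close>, in the direction \<open>(y, -2G)\<close>.\<close>

lemma spray_eq_frechet_derivative:
  assumes "\<phi> differentiable at z"
  shows "spray f \<phi> z = frechet_derivative \<phi> (at z) (snd z, \<chi> j. - 2 * spray_coeff f j z)"
  unfolding spray_def frechet_derivative_eq_sum_dx_dy[OF assms]
  by (simp add: sum_distrib_left sum_negf mult.assoc)

lemma smooth_on_dx: "smooth_on S \<phi> \<Longrightarrow> smooth_on S (dx i \<phi>)"
  unfolding dx_def[abs_def] by (rule smooth_on_frechet_derivative)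

lemma smooth_on_dy: "smooth_on S \<phi> \<Longrightarrow> smooth_on S (dy i \<phi>)"
  unfolding dy_def[abs_def] by (rule smooth_on_frechet_derivative)

lemma smooth_on_snd_component: "open S \<Longrightarrow> smooth_on S (\<lambda>z :: 'a::real_normed_vector \<times> (real ^ 'n::finite). snd z $ i)"
  by (rule smooth_on_bounded_linear)
    (auto intro: bounded_linear_compose[OF bounded_linear_vec_nth bounded_linear_snd])

definition y_homogeneous ::
  "(real ^ 'n::finite) set \<Rightarrow> nat \<Rightarrow> ((real ^ 'n) \<times> (real ^ 'n) \<Rightarrow> real) \<Rightarrow> bool" where
  "y_homogeneous U m \<phi> \<longleftrightarrow>
     (\<forall>x\<in>U. \<forall>y. y \<noteq> 0 \<longrightarrow> (\<forall>r>0. \<phi> (x, r *\<^sub>R y) = r ^ m * \<phi> (x, y)))"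

lemma y_homogeneousD:
  "y_homogeneous U m \<phi> \<Longrightarrow> x \<in> U \<Longrightarrow> y \<noteq> 0 \<Longrightarrow> r > 0 \<Longrightarrow> \<phi> (x, r *\<^sub>R y) = r ^ m * \<phi> (x, y)"
  by (simp add: y_homogeneous_def)

lemma open_slit: "open U \<Longrightarrow> open (U \<times> - {0 :: 'a::{t1_space, zero}})"
  by (intro open_Times) auto

text \<open>Differentiate \<open>\<phi>(x, r y) = r\<^sup>m \<phi>(x, y)\<close> at \<open>(x, y)\<close>; the chain rule stretches the vertical part
  of the direction by \<open>r\<close>. Hence horizontal derivatives keep the degree and vertical ones lower it.\<close>

lemma frechet_derivative_y_homogeneous:
  assumes U: "open U" and \<phi>: "smooth_on (U \<times> - {0}) \<phi>" "y_homogeneous U m \<phi>"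
    and x: "x \<in> U" and y: "y \<noteq> 0" and r: "r > 0"
  shows "frechet_derivative \<phi> (at (x, r *\<^sub>R y)) (u, r *\<^sub>R v) = r ^ m * frechet_derivative \<phi> (at (x, y)) (u, v)"
proof -
  define h where "h = (\<lambda>z :: (real ^ 'a) \<times> (real ^ 'a). (fst z, r *\<^sub>R snd z))"
  have h: "(h has_derivative h) (at (x, y))"
    unfolding h_def by (auto intro!: derivative_eq_intros)
  have "(\<phi> has_derivative frechet_derivative \<phi> (at (h (x, y)))) (at (h (x, y)))"
    using x y r by (intro smooth_on_has_derivative[OF \<phi>(1)]) (simp add: h_def)
  then have "((\<lambda>z. \<phi> (h z)) has_derivative (\<lambda>w. frechet_derivative \<phi> (at (h (x, y))) (h w))) (at (x, y))"
    using diff_chain_at[OF h] by (simp add: o_def)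
  moreover have "((\<lambda>z. \<phi> (h z)) has_derivative (\<lambda>w. r ^ m * frechet_derivative \<phi> (at (x, y)) w)) (at (x, y))"
  proof (rule has_derivative_transform_within_open[OF _ open_slit[OF U]])
    show "((\<lambda>z. r ^ m * \<phi> z) has_derivative (\<lambda>w. r ^ m * frechet_derivative \<phi> (at (x, y)) w)) (at (x, y))"
      using x y by (intro has_derivative_mult_right smooth_on_has_derivative[OF \<phi>(1)]) simp
    show "(x, y) \<in> U \<times> - {0}"
      using x y by simp
    show "r ^ m * \<phi> z = \<phi> (h z)" if "z \<in> U \<times> - {0}" for z
      using y_homogeneousD[OF \<phi>(2) _ _ r] that by (cases z) (simp add: h_def)
  qed
  ultimately have "(\<lambda>w. frechet_derivative \<phi> (at (h (x, y))) (h w))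
      = (\<lambda>w. r ^ m * frechet_derivative \<phi> (at (x, y)) w)"
    by (rule has_derivative_unique)
  from fun_cong[OF this, of "(u, v)"] show ?thesis
    by (simp add: h_def)
qed

lemma y_homogeneous_dx:
  assumes "open U" "smooth_on (U \<times> - {0}) \<phi>" "y_homogeneous U m \<phi>"
  shows "y_homogeneous U m (dx i \<phi>)"
  using frechet_derivative_y_homogeneous[OF assms, where v = 0]
  by (simp add: y_homogeneous_def dx_def)

lemma y_homogeneous_dy:
  assumes "open U" "smooth_on (U \<times> - {0}) \<phi>" "y_homogeneous U (Suc m) \<phi>"
  shows "y_homogeneous U m (dy i \<phi>)"
  unfolding y_homogeneous_def
proof (intro ballI allI impI)
  fix x y :: "real ^ 'a" and r :: real
  assume *: "x \<in> U" "y \<noteq> 0" "r > 0"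
  let ?D = "frechet_derivative \<phi> (at (x, r *\<^sub>R y))"
  have "\<phi> differentiable at (x, r *\<^sub>R y)"
    using * by (intro smooth_on_differentiable[OF assms(2)]) simp
  then have "r * dy i \<phi> (x, r *\<^sub>R y) = ?D (0, r *\<^sub>R axis i 1)"
    using linear_scale[OF linear_frechet_derivative, of \<phi> _ r "(0, axis i 1)"] by (simp add: dy_def)
  also have "\<dots> = r * (r ^ m * dy i \<phi> (x, y))"
    using frechet_derivative_y_homogeneous[OF assms *, where u = 0 and v = "axis i 1"]
    by (simp add: dy_def)
  finally have "r * dy i \<phi> (x, r *\<^sub>R y) = r * (r ^ m * dy i \<phi> (x, y))" .
  then show "dy i \<phi> (x, r *\<^sub>R y) = r ^ m * dy i \<phi> (x, y)"
    using * by simp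
qed

text \<open>Euler's relation compares the derivatives at \<open>s = 1\<close> of the two expressions for \<open>\<phi>(x, s y)\<close>.\<close>

lemma euler_y_homogeneous:
  assumes "smooth_on (U \<times> - {0}) \<phi>" "y_homogeneous U m \<phi>" "x \<in> U" "y \<noteq> 0"
  shows "(\<Sum>i\<in>UNIV. y $ i * dy i \<phi> (x, y)) = m * \<phi> (x, y)"
proof -
  have \<phi>: "\<phi> differentiable at ((x, 0) + 1 *\<^sub>R (0, y))"
    using assms(3,4) by (intro smooth_on_differentiable[OF assms(1)]) simp
  have "((\<lambda>s. \<phi> ((x, 0) + s *\<^sub>R (0, y))) has_real_derivative frechet_derivative \<phi> (at (x, y)) (0, y)) (at 1)"
    using has_real_derivative_along_line[OF \<phi>] by simp
  moreover have "((\<lambda>s. \<phi> ((x, 0) + s *\<^sub>R (0, y))) has_real_derivative m * \<phi> (x, y)) (at 1)"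
  proof (rule has_field_derivative_transform_within_open[of "\<lambda>s. s ^ m * \<phi> (x, y)" _ _ "{0<..}"])
    show "((\<lambda>s. s ^ m * \<phi> (x, y)) has_real_derivative m * \<phi> (x, y)) (at 1)"
      by (auto intro!: derivative_eq_intros)
  qed (use y_homogeneousD[OF assms(2-4)] in auto)
  ultimately have "frechet_derivative \<phi> (at (x, y)) (0, y) = m * \<phi> (x, y)"
    by (rule DERIV_unique)
  then show ?thesis
    using frechet_derivative_eq_sum_dx_dy[OF \<phi>, of 0 y] by simp
qed

section \<open>The spray of a Finsler function in a chart\<close>

text \<open>The part of the hypotheses on a Finsler space that the local computation refers to, for the
  expression \<open>f\<close> of the Finsler function over the image \<open>U\<close> of a single chart.\<close>

locale finsler_chart =
  fixes U :: "(real ^ 'n::finite) set" and f :: "(real ^ 'n) \<times> (real ^ 'n) \<Rightarrow> real"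
  assumes open_U: "open U"
    and smooth_f: "smooth_on (U \<times> - {0}) f"
    and homogeneous_f: "y_homogeneous U 1 f"
    and regular: "z \<in> U \<times> - {0} \<Longrightarrow> rank (metric f z) = CARD('n)"
begin

abbreviation S where "S \<equiv> U \<times> - {0 :: real ^ 'n}"

lemma open_S: "open S"
  by (rule open_slit[OF open_U])

lemma smooth_f_square: "smooth_on S (\<lambda>w. (f w)\<^sup>2)"
  unfolding power2_eq_square by (rule smooth_on_mult[OF open_S smooth_f smooth_f])

lemma smooth_energy: "smooth_on S (\<lambda>w. (f w)\<^sup>2 / 2)"
  using smooth_on_mult[OF open_S smooth_f_square smooth_on_const[OF open_S, of "1/2"]] by simp

lemma homogeneous_f_square: "y_homogeneous U (Suc 1) (\<lambda>w. (f w)\<^sup>2)"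
  using homogeneous_f by (simp add: y_homogeneous_def power2_eq_square)

lemma homogeneous_energy: "y_homogeneous U (Suc (Suc 0)) (\<lambda>w. (f w)\<^sup>2 / 2)"
  using homogeneous_f by (simp add: y_homogeneous_def power2_eq_square)

lemma smooth_metric: "smooth_on S (\<lambda>z. metric f z $ i $ j)"
  by (simp add: metric_def smooth_on_dy smooth_energy)

lemma homogeneous_metric: "x \<in> U \<Longrightarrow> y \<noteq> 0 \<Longrightarrow> r > 0 \<Longrightarrow> metric f (x, r *\<^sub>R y) = metric f (x, y)"
  using y_homogeneousD[OF y_homogeneous_dy[OF open_U smooth_on_dy[OF smooth_energy]
        y_homogeneous_dy[OF open_U smooth_energy homogeneous_energy]]]
  by (simp add: metric_def vec_eq_iff)

lemma smooth_spray_coeff: "smooth_on S (spray_coeff f i)"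
proof -
  have "det (metric f z) \<noteq> 0" if "z \<in> S" for z
    using regular[OF that] by (simp add: det_eq_0_rank)
  then have inv: "smooth_on S (\<lambda>z. matrix_inv (metric f z) $ i $ j)" for i j
    by (intro smooth_on_matrix_inv[OF open_S] smooth_metric)
  show ?thesis
    unfolding spray_coeff_def[abs_def]
    by (intro smooth_on_mult[OF open_S] smooth_on_sum[OF open_S] smooth_on_diff[OF open_S] inv
      smooth_on_const[OF open_S] smooth_on_snd_component[OF open_S] smooth_on_dx smooth_on_dy smooth_f_square)
qed

lemma homogeneous_spray_coeff: "y_homogeneous U 2 (spray_coeff f i)"
  unfolding y_homogeneous_def
proof (intro ballI allI impI)
  fix x y :: "real ^ 'n" and r :: real
  assume *: "x \<in> U" "y \<noteq> 0" "r > 0"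
  have "dx k (dy l (\<lambda>w. (f w)\<^sup>2)) (x, r *\<^sub>R y) = r * dx k (dy l (\<lambda>w. (f w)\<^sup>2)) (x, y)" for k l
    using y_homogeneousD[OF y_homogeneous_dx[OF open_U smooth_on_dy[OF smooth_f_square]
          y_homogeneous_dy[OF open_U smooth_f_square homogeneous_f_square]] *] by simp
  moreover have "dx l (\<lambda>w. (f w)\<^sup>2) (x, r *\<^sub>R y) = r\<^sup>2 * dx l (\<lambda>w. (f w)\<^sup>2) (x, y)" for l
    using y_homogeneousD[OF y_homogeneous_dx[OF open_U smooth_f_square homogeneous_f_square] *]
    by (simp add: power2_eq_square)
  ultimately show "spray_coeff f i (x, r *\<^sub>R y) = r\<^sup>2 * spray_coeff f i (x, y)"
    unfolding spray_coeff_def homogeneous_metric[OF *]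
    by (simp add: sum_distrib_left right_diff_distrib power2_eq_square mult_ac)
qed

lemma smooth_nonlinear_conn: "smooth_on S (nonlinear_conn f h j)"
  unfolding nonlinear_conn_def by (rule smooth_on_dy[OF smooth_spray_coeff])

lemma homogeneous_nonlinear_conn: "y_homogeneous U 1 (nonlinear_conn f h j)"
  unfolding nonlinear_conn_def
  using homogeneous_spray_coeff by (intro y_homogeneous_dy[OF open_U smooth_spray_coeff]) (simp add: numeral_2_eq_2)

lemma euler_spray_coeff:
  "x \<in> U \<Longrightarrow> y \<noteq> 0 \<Longrightarrow> (\<Sum>j\<in>UNIV. y $ j * nonlinear_conn f h j (x, y)) = 2 * spray_coeff f h (x, y)"
  using euler_y_homogeneous[OF smooth_spray_coeff homogeneous_spray_coeff] by (simp add: nonlinear_conn_def)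

lemma euler_nonlinear_conn:
  "x \<in> U \<Longrightarrow> y \<noteq> 0 \<Longrightarrow> (\<Sum>i\<in>UNIV. y $ i * berwald_coeff f h i j (x, y)) = nonlinear_conn f h j (x, y)"
  using euler_y_homogeneous[OF smooth_nonlinear_conn homogeneous_nonlinear_conn] by (simp add: berwald_coeff_def)

section \<open>Parallel 1-forms annihilate the Riemann curvature\<close>

lemma has_derivative_comp_fst:
  assumes "smooth_on U \<phi>" "fst z \<in> U"
  shows "((\<lambda>z :: _ \<times> (real ^ 'n). \<phi> (fst z)) has_derivative
    (\<lambda>w. frechet_derivative \<phi> (at (fst z)) (fst w))) (at z)"
  using diff_chain_at[OF has_derivative_fst[OF has_derivative_ident] smooth_on_has_derivative[OF assms]]
  by (simp add: o_def)

text \<open>The contracted Ricci identity for a parallel 1-form, along the lines of the computation described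
  at the beginning.\<close>

lemma parallel_form_annihilates_curvature:
  fixes b :: "'n \<Rightarrow> real ^ 'n \<Rightarrow> real"
  assumes smooth_b: "\<And>i. smooth_on U (b i)"
    and parallel: "\<And>x y i j. x \<in> U \<Longrightarrow> y \<noteq> 0 \<Longrightarrow>
      frechet_derivative (b i) (at x) (axis j 1) = (\<Sum>h\<in>UNIV. berwald_coeff f h i j (x, y) * b h x)"
    and x: "x \<in> U" and y: "y \<noteq> 0"
  shows "(\<Sum>h\<in>UNIV. b h x * jacobi_endo f h j (x, y)) = 0"
proof -
  define B where "B i j = (\<lambda>x. frechet_derivative (b i) (at x) (axis j 1))" for i j
  define G where "G = spray_coeff f"
  define N where "N = nonlinear_conn f"
  let ?DB = "\<lambda>i j. frechet_derivative (B i j) (at x)"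
  let ?z = "(x, y)"
  have z: "?z \<in> S"
    using x y by simp
  have smooth_B: "smooth_on U (B i j)" for i j
    unfolding B_def by (rule smooth_on_frechet_derivative[OF smooth_b])
  have smooth_N: "smooth_on S (N h j)" and smooth_G: "smooth_on S (G h)" for h j
    unfolding N_def G_def by (rule smooth_nonlinear_conn smooth_spray_coeff)+
  have b_deriv: "frechet_derivative (b h) (at x) u = (\<Sum>k\<in>UNIV. u $ k * B h k x)" for h u
    unfolding B_def
    by (rule linear_eq_sum_axis[OF linear_frechet_derivative[OF smooth_on_differentiable[OF smooth_b x]]])
  have B_deriv: "?DB i j u = (\<Sum>k\<in>UNIV. u $ k * ?DB i j (axis k 1))" for i j u
    by (rule linear_eq_sum_axis[OF linear_frechet_derivative[OF smooth_on_differentiable[OF smooth_B x]]])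

  \<comment> \<open>The relations \<open>b\<^sub>h N\<^sup>h\<^sub>j = y\<^sup>i B\<^sub>i\<^sub>j\<close> and \<open>2 b\<^sub>h G\<^sup>h = y\<^sup>i y\<^sup>j B\<^sub>i\<^sub>j\<close>, from parallelism and Euler's
    relation for functions of degree 1 and 2.\<close>
  have bN: "(\<Sum>h\<in>UNIV. b h (fst w) * N h j w) = (\<Sum>i\<in>UNIV. snd w $ i * B i j (fst w))"
    if wS: "w \<in> S" for w j
  proof -
    obtain x y where w: "w = (x, y)" "x \<in> U" "y \<noteq> 0"
      using wS by auto
    have "(\<Sum>i\<in>UNIV. y $ i * B i j x) = (\<Sum>i\<in>UNIV. \<Sum>h\<in>UNIV. y $ i * (berwald_coeff f h i j (x, y) * b h x))"
      unfolding B_def parallel[OF w(2,3)] sum_distrib_left ..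
    also have "\<dots> = (\<Sum>h\<in>UNIV. b h x * (\<Sum>i\<in>UNIV. y $ i * berwald_coeff f h i j (x, y)))"
      by (subst sum.swap) (simp add: sum_distrib_left mult_ac)
    finally show ?thesis
      using euler_nonlinear_conn[OF w(2,3)] by (simp add: w(1) N_def)
  qed
  have bG: "2 * (\<Sum>h\<in>UNIV. b h (fst w) * G h w)
      = (\<Sum>i\<in>UNIV. \<Sum>j\<in>UNIV. snd w $ i * snd w $ j * B i j (fst w))"
    if wS: "w \<in> S" for w
  proof -
    obtain x y where w: "w = (x, y)" "x \<in> U" "y \<noteq> 0"
      using wS by auto
    have "2 * (\<Sum>h\<in>UNIV. b h x * G h (x, y)) = (\<Sum>h\<in>UNIV. b h x * (\<Sum>j\<in>UNIV. y $ j * N h j (x, y)))"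
      using euler_spray_coeff[OF w(2,3)] by (simp add: sum_distrib_left N_def G_def mult_ac)
    also have "\<dots> = (\<Sum>j\<in>UNIV. y $ j * (\<Sum>h\<in>UNIV. b h x * N h j (x, y)))"
      unfolding sum_distrib_left by (subst sum.swap) (simp add: mult_ac)
    also have "\<dots> = (\<Sum>j\<in>UNIV. y $ j * (\<Sum>i\<in>UNIV. y $ i * B i j x))"
      using bN[OF wS] by (simp add: w(1))
    also have "\<dots> = (\<Sum>i\<in>UNIV. \<Sum>j\<in>UNIV. y $ i * y $ j * B i j x)"
      unfolding sum_distrib_left by (subst sum.swap) (simp add: mult_ac)
    finally show ?thesis
      by (simp add: w(1))
  qed

  \<comment> \<open>Both relations hold on an open set, so they may be differentiated in any direction \<open>(u, v)\<close>.\<close>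
  have snd_deriv: "((\<lambda>w :: (real ^ 'n) \<times> (real ^ 'n). snd w $ i) has_derivative (\<lambda>w. snd w $ i)) (at ?z)" for i
    by (intro bounded_linear_imp_has_derivative bounded_linear_compose[OF bounded_linear_vec_nth bounded_linear_snd])
  have bN_deriv: "(\<Sum>h\<in>UNIV. b h x * frechet_derivative (N h j) (at ?z) (u, v)
        + frechet_derivative (b h) (at x) u * N h j ?z)
      = (\<Sum>i\<in>UNIV. y $ i * ?DB i j u + v $ i * B i j x)" for j u v
  proof -
    have "((\<lambda>w. \<Sum>h\<in>UNIV. b h (fst w) * N h j w) has_derivative
        (\<lambda>w. \<Sum>h\<in>UNIV. b h (fst ?z) * frechet_derivative (N h j) (at ?z) w
          + frechet_derivative (b h) (at (fst ?z)) (fst w) * N h j ?z)) (at ?z)" (is "(_ has_derivative ?L) _")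
      by (intro has_derivative_sum has_derivative_mult has_derivative_comp_fst smooth_b
          smooth_on_has_derivative[OF smooth_N z]) (use x in simp)
    moreover have "((\<lambda>w. \<Sum>h\<in>UNIV. b h (fst w) * N h j w) has_derivative
        (\<lambda>w. \<Sum>i\<in>UNIV. snd ?z $ i * frechet_derivative (B i j) (at (fst ?z)) (fst w) + snd w $ i * B i j (fst ?z))) (at ?z)"
      (is "(_ has_derivative ?R) _")
    proof (rule has_derivative_transform_within_open[OF _ open_S z bN[symmetric]])
      show "((\<lambda>w. \<Sum>i\<in>UNIV. snd w $ i * B i j (fst w)) has_derivative ?R) (at ?z)"
        by (intro has_derivative_sum has_derivative_mult has_derivative_comp_fst smooth_B snd_deriv) (use x in simp)
    qed
    ultimately have "?L = ?R"
      by (rule has_derivative_unique)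
    from fun_cong[OF this, of "(u, v)"] show ?thesis
      by simp
  qed
  have bG_deriv: "2 * (\<Sum>h\<in>UNIV. b h x * frechet_derivative (G h) (at ?z) (u, v)
        + frechet_derivative (b h) (at x) u * G h ?z)
      = (\<Sum>i\<in>UNIV. \<Sum>j\<in>UNIV. y $ i * y $ j * ?DB i j u + (y $ i * v $ j + v $ i * y $ j) * B i j x)" for u v
  proof -
    have "((\<lambda>w. 2 * (\<Sum>h\<in>UNIV. b h (fst w) * G h w)) has_derivative
        (\<lambda>w. 2 * (\<Sum>h\<in>UNIV. b h (fst ?z) * frechet_derivative (G h) (at ?z) w
          + frechet_derivative (b h) (at (fst ?z)) (fst w) * G h ?z))) (at ?z)" (is "(_ has_derivative ?L) _")
      by (intro has_derivative_sum has_derivative_mult has_derivative_mult_right has_derivative_comp_fst smooth_b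
          smooth_on_has_derivative[OF smooth_G z]) (use x in simp)
    moreover have "((\<lambda>w. 2 * (\<Sum>h\<in>UNIV. b h (fst w) * G h w)) has_derivative
        (\<lambda>w. \<Sum>i\<in>UNIV. \<Sum>j\<in>UNIV. snd ?z $ i * snd ?z $ j * frechet_derivative (B i j) (at (fst ?z)) (fst w)
          + (snd ?z $ i * snd w $ j + snd w $ i * snd ?z $ j) * B i j (fst ?z))) (at ?z)"
      (is "(_ has_derivative ?R) _")
    proof (rule has_derivative_transform_within_open[OF _ open_S z bG[symmetric]])
      show "((\<lambda>w. \<Sum>i\<in>UNIV. \<Sum>j\<in>UNIV. snd w $ i * snd w $ j * B i j (fst w)) has_derivative ?R) (at ?z)"
        by (intro has_derivative_sum has_derivative_mult has_derivative_comp_fst smooth_B snd_deriv) (use x in simp)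
    qed
    ultimately have "?L = ?R"
      by (rule has_derivative_unique)
    from fun_cong[OF this, of "(u, v)"] show ?thesis
      by simp
  qed

  \<comment> \<open>The vertical derivative of the second relation is \<open>2 b\<^sub>h N\<^sup>h\<^sub>k = y\<^sup>i B\<^sub>i\<^sub>k + y\<^sup>i B\<^sub>k\<^sub>i\<close>, whereas twice
    the first relation is \<open>2 b\<^sub>h N\<^sup>h\<^sub>k = 2 y\<^sup>i B\<^sub>i\<^sub>k\<close>.\<close>
  have B_sym: "(\<Sum>i\<in>UNIV. y $ i * B k i x) = (\<Sum>i\<in>UNIV. y $ i * B i k x)" for k
  proof -
    have lin: "frechet_derivative (b h) (at x) 0 = 0" "?DB i j 0 = 0" for h i j
      by (simp_all add: b_deriv B_deriv[of i j 0])
    have "2 * (\<Sum>h\<in>UNIV. b h x * N h k ?z)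
        = (\<Sum>i\<in>UNIV. \<Sum>j\<in>UNIV. (y $ i * axis k 1 $ j) * B i j x)
        + (\<Sum>i\<in>UNIV. \<Sum>j\<in>UNIV. (axis k 1 $ i * y $ j) * B i j x)"
      using bG_deriv[of 0 "axis k 1"] unfolding lin
      by (simp add: N_def G_def nonlinear_conn_def dy_def distrib_right sum.distrib)
    also have "(\<Sum>i\<in>UNIV. \<Sum>j\<in>UNIV. (y $ i * axis k 1 $ j) * B i j x) = (\<Sum>i\<in>UNIV. y $ i * B i k x)"
      by (intro sum.cong refl) (simp add: axis_def if_distrib[of "\<lambda>t. _ * t * _"] cong: if_cong)
    also have "(\<Sum>i\<in>UNIV. \<Sum>j\<in>UNIV. (axis k 1 $ i * y $ j) * B i j x) = (\<Sum>j\<in>UNIV. y $ j * B k j x)"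
      by (subst sum.swap, intro sum.cong refl) (simp add: axis_def if_distrib[of "\<lambda>t. t * _ * _"] cong: if_cong)
    finally show ?thesis
      using bN[OF z, of k] by simp
  qed
  have DB_sym: "?DB i l (axis j 1) = ?DB i j (axis l 1)" for i j l
    unfolding B_def by (rule second_derivative_symmetric[OF open_U x smooth_b])

  \<comment> \<open>The three terms of the Jacobi endomorphism: the second relation differentiated along \<open>x\<^sup>j\<close>, the
    first one differentiated along the spray, and the first one inserted in the quadratic term.\<close>
  have T1: "(\<Sum>h\<in>UNIV. b h x * (2 * dx j (G h) ?z))
      = (\<Sum>i\<in>UNIV. \<Sum>l\<in>UNIV. y $ i * y $ l * ?DB i l (axis j 1)) - 2 * (\<Sum>h\<in>UNIV. B h j x * G h ?z)"
  proof -
    have "2 * (\<Sum>h\<in>UNIV. b h x * dx j (G h) ?z + B h j x * G h ?z)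
        = (\<Sum>i\<in>UNIV. \<Sum>l\<in>UNIV. y $ i * y $ l * ?DB i l (axis j 1))"
      using bG_deriv[of "axis j 1" 0] by (simp add: dx_def B_def)
    then show ?thesis
      by (simp add: sum.distrib sum_distrib_left algebra_simps)
  qed
  have T2: "(\<Sum>h\<in>UNIV. b h x * spray f (N h j) ?z)
      = (\<Sum>i\<in>UNIV. y $ i * ?DB i j y) - 2 * (\<Sum>h\<in>UNIV. B h j x * G h ?z)
        - (\<Sum>h\<in>UNIV. (\<Sum>k\<in>UNIV. y $ k * B h k x) * N h j ?z)"
  proof -
    have "spray f (N h j) ?z = frechet_derivative (N h j) (at ?z) (y, \<chi> j. - 2 * G j ?z)" for h
      using spray_eq_frechet_derivative[OF smooth_on_differentiable[OF smooth_N z]] by (simp add: G_def)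
    then have "(\<Sum>h\<in>UNIV. b h x * spray f (N h j) ?z + (\<Sum>k\<in>UNIV. y $ k * B h k x) * N h j ?z)
        = (\<Sum>i\<in>UNIV. y $ i * ?DB i j y - 2 * (B i j x * G i ?z))"
      using bN_deriv[of j y "\<chi> j. - 2 * G j ?z"] by (simp add: b_deriv mult_ac)
    then show ?thesis
      by (simp add: sum.distrib sum_subtractf sum_distrib_left[symmetric] algebra_simps)
  qed
  have T3: "(\<Sum>h\<in>UNIV. b h x * (\<Sum>k\<in>UNIV. N h k ?z * N k j ?z))
      = (\<Sum>h\<in>UNIV. (\<Sum>k\<in>UNIV. y $ k * B h k x) * N h j ?z)"
  proof -
    have "(\<Sum>h\<in>UNIV. b h x * (\<Sum>k\<in>UNIV. N h k ?z * N k j ?z))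
        = (\<Sum>k\<in>UNIV. (\<Sum>h\<in>UNIV. b h x * N h k ?z) * N k j ?z)"
      unfolding sum_distrib_left sum_distrib_right by (subst sum.swap) (simp add: mult_ac)
    also have "\<dots> = (\<Sum>h\<in>UNIV. (\<Sum>k\<in>UNIV. y $ k * B h k x) * N h j ?z)"
      using bN[OF z] by (simp add: B_sym)
    finally show ?thesis .
  qed
  have "(\<Sum>i\<in>UNIV. y $ i * ?DB i j y) = (\<Sum>i\<in>UNIV. \<Sum>l\<in>UNIV. y $ i * y $ l * ?DB i l (axis j 1))"
    unfolding B_deriv[of _ j y] DB_sym[of _ _ j] sum_distrib_left by (simp add: mult.assoc)
  then have "(\<Sum>h\<in>UNIV. b h x * (2 * dx j (G h) ?z)) - (\<Sum>h\<in>UNIV. b h x * spray f (N h j) ?z)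
      - (\<Sum>h\<in>UNIV. b h x * (\<Sum>k\<in>UNIV. N h k ?z * N k j ?z)) = 0"
    unfolding T1 T2 T3 by simp
  then show ?thesis
    unfolding jacobi_endo_def G_def[symmetric] N_def[symmetric] sum_subtractf[symmetric]
    by (simp add: algebra_simps)
qed

end

section \<open>Tangent vectors in charts\<close>

text \<open>A function on the tangent bundle is evaluated in a chart through the inverse of the induced
  coordinates. The facts of this section make that inverse explicit: \<open>p\<close> and the components of a
  tangent vector in one chart determine the vector, and every component vector occurs.\<close>

lemma smooth_atlasD:
  assumes "smooth_atlas M A" "c \<in> A"
  shows "openin M (fst c)" "open (chart_image c)"
    "homeomorphic_map (subtopology M (fst c)) (top_of_set (chart_image c)) (snd c)"
  using assms unfolding smooth_atlas_def by blast+

lemma open_image_chart: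
  assumes "smooth_atlas M A" "c \<in> A" "openin M V" "V \<subseteq> fst c"
  shows "open (snd c ` V)"
proof -
  note c = smooth_atlasD[OF assms(1,2)]
  have "openin (subtopology M (fst c)) V"
    using assms(3,4) by (auto simp: openin_subtopology)
  then have "openin (top_of_set (chart_image c)) (snd c ` V)"
    using homeomorphic_imp_open_map[OF c(3)] by (simp add: open_map_def)
  then show ?thesis
    using c(2) openin_open_eq by blast
qed

lemma inj_on_chart:
  assumes "smooth_atlas M A" "c \<in> A"
  shows "inj_on (snd c) (fst c)"
proof -
  note c = smooth_atlasD[OF assms]
  have "topspace (subtopology M (fst c)) = fst c"
    using openin_subset[OF c(1)] by auto
  then show ?thesis
    using homeomorphic_imp_injective_map[OF c(3)] by simp
qed

lemma transition_apply:
  "smooth_atlas M A \<Longrightarrow> c \<in> A \<Longrightarrow> p \<in> fst c \<Longrightarrow> transition c d (snd c p) = snd d p"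
  by (simp add: transition_def inv_into_f_f[OF inj_on_chart])

lemma transition_differentiable:
  assumes "smooth_atlas M A" "c \<in> A" "d \<in> A" "p \<in> fst c" "p \<in> fst d"
  shows "transition c d differentiable at (snd c p)"
  using assms by (intro smooth_on_differentiable[of "snd c ` (fst c \<inter> fst d)"]) (auto simp: smooth_atlas_def)

text \<open>The chain rule for \<open>transition d e \<circ> transition c d\<close>, which agrees with \<open>transition c e\<close> on
  the image of the triple overlap; that set is open because charts are open maps.\<close>

lemma frechet_derivative_transition_cocycle:
  assumes A: "smooth_atlas M A" and c: "c \<in> A" "p \<in> fst c" and d: "d \<in> A" "p \<in> fst d"
    and e: "e \<in> A" "p \<in> fst e"
  shows "frechet_derivative (transition d e) (at (snd d p)) (frechet_derivative (transition c d) (at (snd c p)) y)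
    = frechet_derivative (transition c e) (at (snd c p)) y"
proof -
  let ?V = "fst c \<inter> fst d \<inter> fst e"
  have diff: "transition c d differentiable at (snd c p)" "transition d e differentiable at (snd d p)"
      "transition c d (snd c p) = snd d p"
    using transition_differentiable[OF A] transition_apply[OF A] c d e by auto
  have "openin M ?V"
    using smooth_atlasD(1)[OF A] c d e by (intro openin_Int) auto
  then have "open (snd c ` ?V)"
    by (intro open_image_chart[OF A c(1)]) auto
  then have "frechet_derivative (transition d e \<circ> transition c d) (at (snd c p))
      = frechet_derivative (transition c e) (at (snd c p))"
    using diff c d e transition_apply[OF A c(1), of _ d] transition_apply[OF A c(1), of _ e]
      transition_apply[OF A d(1), of _ e]
    by (intro frechet_derivative_transform_within_open[of _ _ "snd c ` ?V"] differentiable_chain_at) auto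
  then show ?thesis
    using frechet_derivative_compose[of "transition c d" "snd c p" "transition d e"] diff by (metis comp_apply)
qed

lemma frechet_derivative_transition_self:
  assumes A: "smooth_atlas M A" and c: "c \<in> A" "p \<in> fst c"
  shows "frechet_derivative (transition c c) (at (snd c p)) y = y"
proof -
  have "frechet_derivative id (at (snd c p)) = frechet_derivative (transition c c) (at (snd c p))"
    using smooth_atlasD(2)[OF A c(1)] transition_apply[OF A c(1), of _ c] c(2)
    by (intro frechet_derivative_transform_within_open[of _ _ "chart_image c"]) (auto simp: chart_image_def id_def)
  then show ?thesis
    by (metis frechet_derivative_id id_apply)
qed

text \<open>The cocycle property makes the transforms of \<open>y\<close> under the Jacobians a compatible family.\<close>

lemma tangent_vector_with_components_exists:
  assumes A: "smooth_atlas M A" and c: "c \<in> A" "p \<in> fst c"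
  shows "\<exists>v\<in>tangent_space A p. v c = y"
proof -
  let ?v = "\<lambda>d. if d \<in> A \<and> p \<in> fst d then frechet_derivative (transition c d) (at (snd c p)) y else 0"
  have "?v c = y"
    using frechet_derivative_transition_self[OF A c] c by simp
  moreover have "?v \<in> tangent_space A p"
    using frechet_derivative_transition_cocycle[OF A c] by (auto simp: tangent_space_def)
  ultimately show ?thesis
    by (rule bexI[where x = ?v])
qed

lemma tangent_vector_components:
  assumes "v \<in> tangent_space A p"
  shows "c \<in> A \<Longrightarrow> d \<in> A \<Longrightarrow> p \<in> fst c \<Longrightarrow> p \<in> fst d \<Longrightarrow>
      v d = frechet_derivative (transition c d) (at (snd c p)) (v c)"
    and "\<not> (c \<in> A \<and> p \<in> fst c) \<Longrightarrow> v c = 0"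
  using assms unfolding tangent_space_def by blast+

lemma tangent_vector_eqI:
  assumes "v \<in> tangent_space A p" "w \<in> tangent_space A p" "c \<in> A" "p \<in> fst c" "v c = w c"
  shows "v = w"
proof
  fix d
  show "v d = w d"
    using tangent_vector_components[OF assms(1)] tangent_vector_components[OF assms(2)] assms(3-5)
    by metis
qed

lemma local_rep_apply:
  assumes A: "smooth_atlas M A" and c: "c \<in> A" "p \<in> fst c" and v: "v \<in> tangent_space A p"
  shows "local_rep A c f (snd c p, v c) = f (p, v)"
proof -
  have "inj_on (induced_coords c) (Sigma (fst c) (tangent_space A))"
    using inj_on_chart[OF A c(1)] tangent_vector_eqI[OF _ _ c(1)]
    by (auto simp: inj_on_def induced_coords_def)
  from inv_into_f_f[OF this, of "(p, v)"] show ?thesis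
    using c v by (simp add: local_rep_def induced_coords_def)
qed

lemma induced_coords_cases:
  assumes "smooth_atlas M A" "c \<in> A" "x \<in> chart_image c"
  obtains p v where "p \<in> fst c" "v \<in> tangent_space A p" "x = snd c p" "y = v c"
proof -
  obtain p where "p \<in> fst c" "x = snd c p"
    using assms(3) by (auto simp: chart_image_def)
  moreover obtain v where "v \<in> tangent_space A p" "v c = y"
    using tangent_vector_with_components_exists[OF assms(1,2) \<open>p \<in> fst c\<close>] by blast
  ultimately show thesis
    using that[of p v] by simp
qed

lemma tangent_space_scaleR:
  assumes A: "smooth_atlas M A" and v: "v \<in> tangent_space A p"
  shows "(\<lambda>c. r *\<^sub>R v c) \<in> tangent_space A p"
  unfolding tangent_space_def
proof (intro CollectI conjI ballI impI allI)
  fix c d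
  assume c: "c \<in> A" and d: "d \<in> A" and p: "p \<in> fst c \<inter> fst d"
  then have "linear (frechet_derivative (transition c d) (at (snd c p)))"
    by (intro linear_frechet_derivative transition_differentiable[OF A]) auto
  moreover have "v d = frechet_derivative (transition c d) (at (snd c p)) (v c)"
    using tangent_vector_components(1)[OF v c d] p by blast
  ultimately show "r *\<^sub>R v d = frechet_derivative (transition c d) (at (snd c p)) (r *\<^sub>R v c)"
    by (simp add: linear_scale)
next
  fix c
  assume "\<not> (c \<in> A \<and> p \<in> fst c)"
  then have "v c = 0"
    by (rule tangent_vector_components(2)[OF v])
  then show "r *\<^sub>R v c = 0"
    by simp
qed

lemma slit_tangent_bundleI:
  assumes "smooth_atlas M A" "c \<in> A" "p \<in> fst c" "v \<in> tangent_space A p" "v c \<noteq> 0"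
  shows "(p, v) \<in> slit_tangent_bundle M A"
  using assms openin_subset[OF smooth_atlasD(1)[OF assms(1,2)]]
  by (auto simp: slit_tangent_bundle_def tangent_bundle_def)

lemma finsler_spaceD:
  fixes A :: "('m, 'n::finite) chart set"
  assumes "finsler_space M A F"
  shows "smooth_atlas M A" "CARD('n) \<ge> 2" "\<And>u. u \<in> slit_tangent_bundle M A \<Longrightarrow> F u > 0" "smooth_on_slit A F"
    "\<And>p v r. (p, v) \<in> tangent_bundle M A \<Longrightarrow> r > 0 \<Longrightarrow> F (p, \<lambda>c. r *\<^sub>R v c) = r * F (p, v)"
    "\<And>c z. c \<in> A \<Longrightarrow> z \<in> slit_coords c \<Longrightarrow> rank (metric (local_rep A c F) z) = CARD('n)"
  using assms unfolding finsler_space_def smooth_manifold_def by blast+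

lemma finsler_chart_local_rep:
  fixes A :: "('m, 'n::finite) chart set"
  assumes F: "finsler_space M A F" and c: "c \<in> A"
  shows "finsler_chart (chart_image c) (local_rep A c F)"
proof
  have A: "smooth_atlas M A"
    by (rule finsler_spaceD(1)[OF F])
  show "open (chart_image c)"
    by (rule smooth_atlasD(2)[OF A c])
  show "smooth_on (chart_image c \<times> - {0}) (local_rep A c F)"
    using finsler_spaceD(4)[OF F] c by (simp add: smooth_on_slit_def slit_coords_def)
  show "rank (metric (local_rep A c F) z) = CARD('n)" if "z \<in> chart_image c \<times> - {0}" for z
    using finsler_spaceD(6)[OF F c] that by (simp add: slit_coords_def)
  show "y_homogeneous (chart_image c) 1 (local_rep A c F)"
    unfolding y_homogeneous_def
  proof (intro ballI allI impI)
    fix x y and r :: real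
    assume x: "x \<in> chart_image c" and r: "r > 0"
    obtain p v where pv: "p \<in> fst c" "v \<in> tangent_space A p" "x = snd c p" "y = v c"
      using induced_coords_cases[OF A c x] .
    have "(p, v) \<in> tangent_bundle M A"
      using pv openin_subset[OF smooth_atlasD(1)[OF A c]] by (auto simp: tangent_bundle_def)
    then have "F (p, \<lambda>c. r *\<^sub>R v c) = r * F (p, v)"
      using finsler_spaceD(5)[OF F] r by blast
    then show "local_rep A c F (x, r *\<^sub>R y) = r ^ 1 * local_rep A c F (x, y)"
      using local_rep_apply[OF A c pv(1), of "\<lambda>c. r *\<^sub>R v c" F] local_rep_apply[OF A c pv(1,2), of F]
        tangent_space_scaleR[OF A pv(2)] pv by simp
  qed
qed

section \<open>Non-vanishing scalar curvature excludes parallel 1-forms\<close>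

theorem theorem4p2:
  fixes M :: "'m topology"
    and A :: "('m, 'n::finite) chart set"
    and F K :: "('m, 'n) tangent \<Rightarrow> real"
  assumes "finsler_space M A F"
    and "has_scalar_curvature A F K"
    and "\<forall>u\<in>slit_tangent_bundle M A. K u \<noteq> 0"
  shows "\<not> (\<exists>\<beta>. one_form A \<beta> \<and> (\<exists>u\<in>tangent_bundle M A. \<beta> u \<noteq> 0) \<and> parallel A F \<beta>)"
proof
  assume "\<exists>\<beta>. one_form A \<beta> \<and> (\<exists>u\<in>tangent_bundle M A. \<beta> u \<noteq> 0) \<and> parallel A F \<beta>"
  then obtain \<beta> p v where \<beta>: "one_form A \<beta>" "parallel A F \<beta>"
    and pv: "(p, v) \<in> tangent_bundle M A" "\<beta> (p, v) \<noteq> 0"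
    by auto
  have A: "smooth_atlas M A" and dim: "CARD('n) \<ge> 2"
    by (rule finsler_spaceD[OF assms(1)])+
  obtain c where c: "c \<in> A" "p \<in> fst c"
    using A pv(1) unfolding smooth_atlas_def tangent_bundle_def by blast
  define x where "x = snd c p"
  define f where "f = local_rep A c F"
  define b where "b = form_coeff A c \<beta>"
  have x: "x \<in> chart_image c"
    using c by (simp add: x_def chart_image_def)
  have "(\<Sum>i\<in>UNIV. b i x * v c $ i) = \<beta> (p, v)"
    using \<beta>(1) c x pv(1) local_rep_apply[OF A c, of v \<beta>]
    by (simp add: one_form_def b_def x_def tangent_bundle_def)
  then obtain i where i: "b i x \<noteq> 0"
    using pv(2) by (metis (no_types, lifting) mult_zero_left sum.neutral)

  \<comment> \<open>A nonzero vector in the kernel of \<open>\<beta>\<close> at \<open>x\<close>: in its direction the term \<open>y\<^sub>i \<beta>(y)\<close> of the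
    curvature drops out.\<close>
  obtain y :: "real ^ 'n" where y: "y \<noteq> 0" "orthogonal (\<chi> h. b h x) y"
    using orthogonal_to_vector_exists[of "\<chi> h. b h x"] dim by auto
  then have by0: "(\<Sum>h\<in>UNIV. b h x * y $ h) = 0"
    by (simp add: orthogonal_def inner_vec_def)
  obtain q w where qw: "q \<in> fst c" "w \<in> tangent_space A q" "x = snd c q" "y = w c"
    using induced_coords_cases[OF A c(1) x] .
  have slit: "(q, w) \<in> slit_tangent_bundle M A"
    using slit_tangent_bundleI[OF A c(1) qw(1,2)] y qw by simp
  have f: "f (x, y) > 0" and K: "local_rep A c K (x, y) \<noteq> 0"
    using finsler_spaceD(3)[OF assms(1) slit] assms(3) slit local_rep_apply[OF A c(1) qw(1,2)]
    by (auto simp: f_def qw)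

  interpret finsler_chart "chart_image c" f
    unfolding f_def by (rule finsler_chart_local_rep[OF assms(1) c(1)])
  have bR: "(\<Sum>h\<in>UNIV. b h x * jacobi_endo f h i (x, y)) = 0"
  proof (rule parallel_form_annihilates_curvature[OF _ _ x y(1)])
    show "smooth_on (chart_image c) (b h)" for h
      using \<beta>(1) c by (simp add: one_form_def b_def)
    show "frechet_derivative (b i) (at x) (axis j 1) = (\<Sum>h\<in>UNIV. berwald_coeff f h i j (x, y) * b h x)"
      if "x \<in> chart_image c" "y \<noteq> 0" for x y i j
    proof -
      have "horizontal_deriv A c F \<beta> i j (x, y) = 0"
        using \<beta>(2) c(1) that by (simp add: parallel_def slit_coords_def)
      then show ?thesis
        by (simp add: horizontal_deriv_def b_def f_def)
    qed
  qed
  have jacobi: "jacobi_endo f h i (x, y) = local_rep A c K (x, y) *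
      ((f (x, y))\<^sup>2 * (if h = i then 1 else 0) - y_lower f i (x, y) * y $ h)" for h
    using assms(2) c(1) x y(1) by (simp add: has_scalar_curvature_def slit_coords_def f_def)
  have "(\<Sum>h\<in>UNIV. b h x * jacobi_endo f h i (x, y))
      = (\<Sum>h\<in>UNIV. (if h = i then local_rep A c K (x, y) * (f (x, y))\<^sup>2 * b h x else 0)
          - local_rep A c K (x, y) * y_lower f i (x, y) * (b h x * y $ h))"
    unfolding jacobi by (intro sum.cong) (auto simp: algebra_simps)
  then have "(\<Sum>h\<in>UNIV. b h x * jacobi_endo f h i (x, y)) = local_rep A c K (x, y) * (f (x, y))\<^sup>2 * b i x"
    by (simp add: sum_subtractf sum_distrib_left[symmetric] by0)
  then show False
    using bR f K i by simp
qed

end
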